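(* Let $d\ge 1$, let $\rho\in\mathbb{T}^d$, and let $\theta_n=\theta_0+n\rho \bmod 1$ $(n=0,1,2,\dots)$ be a quasiperiodic trajectory on $\mathbb{T}^d$. Let $\phi:\mathbb{T}^d\to S^1$ be a smooth ($C^\infty$) map, written as $\phi(\theta)=g(\theta)+a\cdot\theta \bmod 1$ with $a=(a_1,\dots,a_d)\in\mathbb{Z}^d$ and $g:\mathbb{T}^d\to\mathbb{R}$ smooth. Put $\hat\Delta(\theta):=a\cdot\rho+g(\theta+\rho)-g(\theta)\in\mathbb{R}$ for $\theta\in\mathbb{T}^d$, and $\hat\Delta_n:=\hat\Delta(\theta_n)$. Then the limit defining the rotation rate $$\rho_\phi:=\left(\lim_{N\to\infty}\frac{1}{N}\sum_{n=0}^{N-1}\hat\Delta_n\right)\bmod 1$$ exists (so $\rho_\phi$ is well defined), and $$\rho_\phi=a\cdot\rho \bmod 1.$$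
   Context: $\mathbb{T}^d=[0,1]^d \bmod 1$ is the $d$-dimensional torus ($\bmod 1$ applied in each coordinate) and $S^1=\mathbb{T}^1=[0,1]\bmod 1$. A point of $\mathbb{T}^d$ is represented by a vector in $[0,1)^d$, and in expressions such as $a\cdot\rho=a_1\rho_1+\cdots+a_d\rho_d$ this real representative of $\rho$ is used. A trajectory $\theta_{n+1}=\theta_n+\rho\bmod 1$ is called quasiperiodic if it is dense in $\mathbb{T}^d$ and $\rho$ is irrational, meaning that the coordinates $\rho_1,\dots,\rho_d$ are irrational and rationally independent (if $b_1,\dots,b_d\in\mathbb{Q}$ and $b_1\rho_1+\cdots+b_d\rho_d=0$ then all $b_k=0$). Every smooth map $\phi:\mathbb{T}^d\to S^1$ has a representation $\phi(\theta)=g(\theta)+a\cdot\theta\bmod 1$ as in the claim. The function $\hat\Delta$ is a continuous real-valued lift of $\Delta(\theta):=\phi(\theta+\rho)-\phi(\theta)\bmod 1$, i.e. $\hat\Delta(\theta)\bmod 1=\Delta(\theta)$. *)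

theory Defs
  imports "HOL-Analysis.Analysis"
begin

text \<open>
  The torus of dimension \<open>CARD('d)\<close> is the set of representatives in \<open>[0,1)\<^sup>d\<close>, and
  \<open>[0,1)\<close> with reduction \<^const>\<open>frac\<close> is the circle. Maps on the torus are functions on
  \<open>real ^ 'd\<close> of which only the values on \<open>torus\<close> are used.
\<close>

definition torus :: "(real ^ 'd) set" where
  "torus = {x. \<forall>i. 0 \<le> x $ i \<and> x $ i < 1}"

definition mod1 :: "real ^ 'd \<Rightarrow> real ^ 'd" where
  "mod1 x = (\<chi> i. frac (x $ i))"

text \<open>
  The quotient topology along \<open>mod1\<close>. It is strictly coarser than the subspace topology of
  \<open>[0,1)\<^sup>d\<close>: opposite faces of the cube are glued.
\<close>

definition torus_topology :: "(real ^ 'd) topology" where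
  "torus_topology = topology (\<lambda>U. U \<subseteq> torus \<and> open (mod1 -` U))"

lemma mod1_in_torus [simp]: "mod1 x \<in> torus"
  by (simp add: mod1_def torus_def frac_lt_1)

lemma mod1_torus: "x \<in> torus \<Longrightarrow> mod1 x = x"
  by (simp add: mod1_def torus_def vec_eq_iff frac_eq)

lemma openin_torus_topology:
  "openin torus_topology U \<longleftrightarrow> U \<subseteq> torus \<and> open (mod1 -` U)"
proof -
  have "istopology (\<lambda>U. U \<subseteq> torus \<and> open (mod1 -` U))"
    unfolding istopology_def by (auto simp: vimage_Union)
  then show ?thesis
    unfolding torus_topology_def by (subst topology_inverse') auto
qed

lemma topspace_torus_topology [simp]: "topspace torus_topology = (torus :: (real ^ 'd) set)"
proof -
  have "mod1 -` torus = (UNIV :: (real ^ 'd) set)"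
    by auto
  then have "openin torus_topology (torus :: (real ^ 'd) set)"
    by (simp add: openin_torus_topology)
  then show ?thesis
    by (metis openin_subset openin_torus_topology openin_topspace subset_antisym)
qed

lemma quotient_map_mod1: "quotient_map euclidean torus_topology mod1"
proof -
  have "range mod1 = torus"
    using mod1_torus by (metis UNIV_I image_eqI mod1_in_torus subsetI subset_antisym image_subset_iff)
  then show ?thesis
    unfolding quotient_map_def by (auto simp: openin_torus_topology vimage_def)
qed


fun Ck_on :: "nat \<Rightarrow> 'a::euclidean_space set \<Rightarrow> ('a \<Rightarrow> real) \<Rightarrow> bool" where
  "Ck_on 0 S f \<longleftrightarrow> continuous_on S f"
| "Ck_on (Suc k) S f \<longleftrightarrow>
     f differentiable_on S \<and> (\<forall>v. Ck_on k S (\<lambda>x. frechet_derivative f (at x) v))"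

text \<open>\<open>Ck_on\<close> and \<open>smooth_on\<close> are only meaningful for open \<open>S\<close>.\<close>

definition smooth_on :: "'a::euclidean_space set \<Rightarrow> ('a \<Rightarrow> real) \<Rightarrow> bool" where
  "smooth_on S f \<longleftrightarrow> (\<forall>k. Ck_on k S f)"

definition smooth_torus_real :: "(real ^ 'd \<Rightarrow> real) \<Rightarrow> bool" where
  "smooth_torus_real g \<longleftrightarrow> smooth_on UNIV (g \<circ> mod1)"

text \<open>
  Smoothness into the circle \<open>\<real>/\<int>\<close>: the \<open>\<int>\<^sup>d\<close>-periodic pullback to \<open>\<real>\<^sup>d\<close> has, near every
  point, a smooth real-valued lift.
\<close>

definition smooth_torus_circle :: "(real ^ 'd \<Rightarrow> real) \<Rightarrow> bool" where
  "smooth_torus_circle \<phi> \<longleftrightarrow>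
     (\<forall>x. \<exists>U h. open U \<and> x \<in> U \<and> smooth_on U h \<and> (\<forall>y\<in>U. \<phi> (mod1 y) = frac (h y)))"


definition trajectory :: "real ^ 'd \<Rightarrow> real ^ 'd \<Rightarrow> nat \<Rightarrow> real ^ 'd" where
  "trajectory \<rho> \<theta>\<^sub>0 n = mod1 (\<theta>\<^sub>0 + real n *\<^sub>R \<rho>)"

definition irrational_vec :: "real ^ 'd \<Rightarrow> bool" where
  "irrational_vec \<rho> \<longleftrightarrow>
     (\<forall>i. \<rho> $ i \<notin> \<rat>) \<and>
     (\<forall>b :: real ^ 'd. (\<forall>i. b $ i \<in> \<rat>) \<and> (\<Sum>i\<in>UNIV. b $ i * \<rho> $ i) = 0 \<longrightarrow> (\<forall>i. b $ i = 0))"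

definition quasiperiodic :: "real ^ 'd \<Rightarrow> real ^ 'd \<Rightarrow> bool" where
  "quasiperiodic \<rho> \<theta>\<^sub>0 \<longleftrightarrow>
     torus_topology closure_of (range (trajectory \<rho> \<theta>\<^sub>0)) = torus \<and> irrational_vec \<rho>"


definition int_dot :: "int ^ 'd \<Rightarrow> real ^ 'd \<Rightarrow> real" where
  "int_dot a x = (\<Sum>i\<in>UNIV. of_int (a $ i) * x $ i)"

definition Delta_hat ::
  "int ^ 'd \<Rightarrow> (real ^ 'd \<Rightarrow> real) \<Rightarrow> real ^ 'd \<Rightarrow> real ^ 'd \<Rightarrow> real" where
  "Delta_hat a g \<rho> \<theta> = int_dot a \<rho> + g (mod1 (\<theta> + \<rho>)) - g \<theta>"

text \<open>
  In the following two definitions \<open>D\<close> is a real-valued lift of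
  \<open>\<phi>(\<theta> + \<rho>) - \<phi>(\<theta>) mod 1\<close>; \<open>Delta_hat_lift\<close> shows that \<open>Delta_hat\<close> is one.
\<close>

definition lift_average ::
  "(real ^ 'd \<Rightarrow> real) \<Rightarrow> real ^ 'd \<Rightarrow> real ^ 'd \<Rightarrow> nat \<Rightarrow> real" where
  "lift_average D \<rho> \<theta>\<^sub>0 N = (1 / real N) * (\<Sum>n<N. D (trajectory \<rho> \<theta>\<^sub>0 n))"

definition rotation_rate :: "(real ^ 'd \<Rightarrow> real) \<Rightarrow> real ^ 'd \<Rightarrow> real ^ 'd \<Rightarrow> real" where
  "rotation_rate D \<rho> \<theta>\<^sub>0 = frac (lim (lift_average D \<rho> \<theta>\<^sub>0))"

lemma frac_eq_iff_diff_Ints: "frac x = frac y \<longleftrightarrow> x - y \<in> \<int>" for x y :: real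
proof
  assume "frac x = frac y"
  then have "x - y = of_int (\<lfloor>x\<rfloor> - \<lfloor>y\<rfloor>)"
    by (simp add: frac_def)
  then show "x - y \<in> \<int>"
    by (metis Ints_of_int)
next
  assume "x - y \<in> \<int>"
  then obtain k where "x = y + of_int k"
    by (metis Ints_cases add.commute diff_add_cancel)
  then show "frac x = frac y"
    by (simp add: frac_def)
qed

lemma Delta_hat_lift:
  assumes \<phi>: "\<And>\<theta>. \<theta> \<in> torus \<Longrightarrow> \<phi> \<theta> = frac (g \<theta> + int_dot a \<theta>)" and \<theta>: "\<theta> \<in> torus"
  shows "frac (Delta_hat a g \<rho> \<theta>) = frac (\<phi> (mod1 (\<theta> + \<rho>)) - \<phi> \<theta>)"
proof -
  have "int_dot a (mod1 (\<theta> + \<rho>)) =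
      int_dot a \<theta> + int_dot a \<rho> - (\<Sum>i\<in>UNIV. of_int (a $ i) * of_int \<lfloor>(\<theta> + \<rho>) $ i\<rfloor>)"
    by (simp add: int_dot_def mod1_def frac_def algebra_simps sum.distrib sum_subtractf)
  then have "Delta_hat a g \<rho> \<theta> - (\<phi> (mod1 (\<theta> + \<rho>)) - \<phi> \<theta>) =
      (\<Sum>i\<in>UNIV. of_int (a $ i) * of_int \<lfloor>(\<theta> + \<rho>) $ i\<rfloor>)
      + of_int \<lfloor>g (mod1 (\<theta> + \<rho>)) + int_dot a (mod1 (\<theta> + \<rho>))\<rfloor> - of_int \<lfloor>g \<theta> + int_dot a \<theta>\<rfloor>"
    by (simp add: Delta_hat_def \<phi> \<theta> frac_def)
  also have "\<dots> \<in> \<int>"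
    by (intro Ints_add Ints_diff Ints_sum Ints_mult Ints_of_int)
  finally show ?thesis
    by (simp add: frac_eq_iff_diff_Ints)
qed

end

theory Submission
  imports Defs
begin

text \<open>
  Along the trajectory the cocycle \<open>g (\<theta> + \<rho>) - g \<theta>\<close> telescopes, so the average differs from
  \<open>a \<cdot> \<rho>\<close> by \<open>(g \<theta>\<^sub>N - g \<theta>\<^sub>0) / N\<close>, which vanishes in the limit because a
  continuous function on the torus is bounded.
\<close>

text \<open>Reducing first changes each coordinate by an integer, which \<open>frac\<close> does not
  see.\<close>

lemma mod1_add_mod1: "mod1 (mod1 x + y) = mod1 (x + y)"
proof -
  have "mod1 x $ i + y $ i - (x $ i + y $ i) = - of_int \<lfloor>x $ i\<rfloor>" for i
    by (simp add: mod1_def frac_def)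
  then have "frac (mod1 x $ i + y $ i) = frac (x $ i + y $ i)" for i
    by (simp add: frac_eq_iff_diff_Ints)
  then show ?thesis
    by (simp add: mod1_def)
qed

text \<open>Turns the shift by \<open>\<rho>\<close> inside \<open>Delta_hat\<close> into an index
  shift, so that the sum along the orbit telescopes.\<close>

lemma mod1_trajectory_add: "mod1 (trajectory \<rho> \<theta>\<^sub>0 n + \<rho>) = trajectory \<rho> \<theta>\<^sub>0 (Suc n)"
proof -
  have "\<theta>\<^sub>0 + real n *\<^sub>R \<rho> + \<rho> = \<theta>\<^sub>0 + real (Suc n) *\<^sub>R \<rho>"
    by (simp add: algebra_simps)
  then show ?thesis
    by (simp only: trajectory_def mod1_add_mod1)
qed

lemma sum_Delta_hat_trajectory:
  "(\<Sum>n<N. Delta_hat a g \<rho> (trajectory \<rho> \<theta>\<^sub>0 n))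
    = real N * int_dot a \<rho> + (g (trajectory \<rho> \<theta>\<^sub>0 N) - g (trajectory \<rho> \<theta>\<^sub>0 0))"
  unfolding Delta_hat_def mod1_trajectory_add
  by (induction N) (simp_all add: algebra_simps)

text \<open>The half-open cube \<open>torus\<close> is not compact in the Euclidean topology, and
  \<open>g\<close> may jump across glued faces. The periodic pullback \<open>g \<circ> mod1\<close>
  is continuous on the compact closed cube and agrees with \<open>g\<close> on
  \<open>torus\<close>.\<close>

lemma bounded_image_torus:
  fixes g :: "real ^ 'd \<Rightarrow> real"
  assumes "continuous_on UNIV (g \<circ> mod1)"
  shows "bounded (g ` torus)"
proof -
  have "compact ((g \<circ> mod1) ` cbox 0 1)"
    by (intro compact_continuous_image continuous_on_subset[OF assms]) auto
  moreover have "g ` torus \<subseteq> (g \<circ> mod1) ` cbox 0 1"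
  proof (rule image_subsetI)
    fix x :: "real ^ 'd"
    assume x: "x \<in> torus"
    then have "x \<in> cbox 0 1"
      by (simp add: torus_def mem_box_cart less_imp_le)
    moreover have "g x = (g \<circ> mod1) x"
      using x by (simp add: mod1_torus)
    ultimately show "g x \<in> (g \<circ> mod1) ` cbox 0 1"
      by (rule rev_image_eqI)
  qed
  ultimately show ?thesis
    using bounded_subset compact_imp_bounded by blast
qed

lemma lift_average_Delta_hat_tendsto:
  assumes "bounded (g ` torus)"
  shows "lift_average (Delta_hat a g \<rho>) \<rho> \<theta>\<^sub>0 \<longlonglongrightarrow> int_dot a \<rho>"
proof -
  let ?d = "\<lambda>N. g (trajectory \<rho> \<theta>\<^sub>0 N) - g (trajectory \<rho> \<theta>\<^sub>0 0)"
  obtain B where B: "\<And>x. x \<in> torus \<Longrightarrow> \<bar>g x\<bar> \<le> B"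
    using assms by (auto simp: bounded_iff)
  \<comment> \<open>Trajectory points are values of \<open>mod1\<close>, hence lie in
    \<open>torus\<close>, and \<open>B\<close> bounds both terms.\<close>
  have "\<bar>?d N\<bar> \<le> 2 * B" for N
    using B[of "trajectory \<rho> \<theta>\<^sub>0 N"] B[of "trajectory \<rho> \<theta>\<^sub>0 0"]
    by (simp add: trajectory_def)
  then have "Bfun ?d sequentially"
    by (intro BfunI[where K = "2 * B"]) simp
  \<comment> \<open>A null sequence times a bounded sequence is null.\<close>
  then have "(\<lambda>N. (1 / real N) * ?d N) \<longlonglongrightarrow> 0"
    using bounded_bilinear.Zfun_prod_Bfun[OF bounded_bilinear_mult] lim_1_over_n[where 'a = real]
    unfolding tendsto_Zfun_iff diff_zero by blast
  then have "(\<lambda>N. int_dot a \<rho> + (1 / real N) * ?d N) \<longlonglongrightarrow> int_dot a \<rho>"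
    using tendsto_add[OF tendsto_const] by fastforce
  \<comment> \<open>Positive \<open>N\<close> is required: at \<open>N = 0\<close> division by zero
    yields 0, so the average is 0 while the left side is \<open>int_dot a \<rho>\<close>.\<close>
  moreover have "\<forall>\<^sub>F N in sequentially.
      int_dot a \<rho> + (1 / real N) * ?d N = lift_average (Delta_hat a g \<rho>) \<rho> \<theta>\<^sub>0 N"
    using eventually_gt_at_top[of 0]
    by eventually_elim (simp add: lift_average_def sum_Delta_hat_trajectory field_simps)
  ultimately show ?thesis
    by (rule Lim_transform_eventually)
qed

theorem proposition1p1:
  fixes \<rho> \<theta>\<^sub>0 :: "real ^ 'd"
    and \<phi> g :: "real ^ 'd \<Rightarrow> real"
    and a :: "int ^ 'd"
  assumes "\<rho> \<in> torus"
    and "\<theta>\<^sub>0 \<in> torus"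
    and "quasiperiodic \<rho> \<theta>\<^sub>0"
    and "smooth_torus_circle \<phi>"
    and "smooth_torus_real g"
    and "\<And>\<theta>. \<theta> \<in> torus \<Longrightarrow> \<phi> \<theta> = frac (g \<theta> + int_dot a \<theta>)"
  shows "convergent (lift_average (Delta_hat a g \<rho>) \<rho> \<theta>\<^sub>0)
    \<and> rotation_rate (Delta_hat a g \<rho>) \<rho> \<theta>\<^sub>0 = frac (int_dot a \<rho>)"
proof -
  \<comment> \<open>Order 0 of smoothness is continuity of the pullback, which gives the bound on
    \<open>g\<close>.\<close>
  have "Ck_on 0 UNIV (g \<circ> mod1)"
    using assms(5) unfolding smooth_torus_real_def smooth_on_def by blast
  then have "lift_average (Delta_hat a g \<rho>) \<rho> \<theta>\<^sub>0 \<longlonglongrightarrow> int_dot a \<rho>"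
    by (intro lift_average_Delta_hat_tendsto bounded_image_torus) simp
  then show ?thesis
    by (auto simp: rotation_rate_def limI intro: convergentI)
qed

end
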